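(* Let $\mathbf{1}$ be the tuple of all $1$'s, and let $$\Delta_{k,(1^{(n-2)},2),\mathbf{1}}=\Big\{x\in\mathbb{R}^n_{\ge 0} : \sum_{i=1}^n x_i=k,\ x_i\le 1 \text{ for } 1\le i\le n-2,\ x_{n-1}+x_n\le 1\Big\}$$ (the base polytope of the panhandle matroid $\mathrm{Pan}_{k,n-2,n}$). Let $0\le m\le n-1$ if $1\le k\le n-2$, and $0\le m\le 2$ if $k=n-1$. Then the coefficient of $t^m$ in $(n-1)!\,\mathrm{ehr}(\Delta_{k,(1^{(n-2)},2),\mathbf{1}},t)$ is positive.
   Context: For a polytope $P\subset\mathbb{R}^n$ with integral vertices, $\mathrm{ehr}(P,t)$ is the (Ehrhart) polynomial in $t$ with $\mathrm{ehr}(P,t)=\#(tP\cap\mathbb{Z}^n)$ for all positive integers $t$. The symbol $1^{(n-2)}$ denotes $n-2$ copies of $1$, and the tuple $\mathbf{1}$ records that all upper bounds in the definition of the polytope are equal to $1$.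
   Formalization: For k = n-1 the range 0 ≤ m ≤ 2 is replaced by 0 ≤ m ≤ 1: there the polytope is a unit segment with Ehrhart polynomial t+1, so the coefficient of t^2 is 0 and the printed claim fails for m = 2. *)

theory Defs
  imports "Jordan_Normal_Form.Matrix" "HOL-Computational_Algebra.Polynomial"
begin

definition integer_points :: "nat \<Rightarrow> real vec set" where
  "integer_points n = {x \<in> carrier_vec n. \<forall>i<n. x $ i \<in> \<int>}"

definition dilate :: "real \<Rightarrow> real vec set \<Rightarrow> real vec set" where
  "dilate t P = (\<lambda>x. t \<cdot>\<^sub>v x) ` P"

(* The polynomial is unique if it exists, because it is prescribed at infinitely many points;
   it exists when P is a polytope with integral vertices (Ehrhart's theorem).  For other P the
   value of ehr is unspecified. *)
definition ehr :: "nat \<Rightarrow> real vec set \<Rightarrow> real poly" where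
  "ehr n P = (THE p. \<forall>t::nat. t > 0 \<longrightarrow>
     poly p (real t) = real (card (dilate (real t) P \<inter> integer_points n)))"

(* Entries of a vec are numbered from 0, so the coordinates x_1, ..., x_n are
   x $ 0, ..., x $ (n - 1). Only meaningful for n >= 2. *)
definition panhandle_polytope :: "nat \<Rightarrow> nat \<Rightarrow> real vec set" where
  "panhandle_polytope n k = {x \<in> carrier_vec n.
     (\<forall>i<n. x $ i \<ge> 0) \<and>
     (\<Sum>i<n. x $ i) = real k \<and>
     (\<forall>i<n - 2. x $ i \<le> 1) \<and>
     x $ (n - 2) + x $ (n - 1) \<le> 1}"

end

theory Submission
  imports Defs "HOL-Computational_Algebra.Polynomial_FPS"
begin

text \<open>
Put \<open>N = n - 2\<close>.  Let \<open>P\<close> be the polynomial \<open>1 + z + \<dots> + z^t\<close>.  The lattice points of the dilated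
polytope are counted by the coefficient of \<open>z^(k t)\<close> in \<open>P^N (z P)'\<close>, and \<open>(N + 1) P^N (z P)' =
(N + 1) P^(N+1) + z (P^(N+1))'\<close>.  Hence \<open>(N + 1) ehr(t) = (k t + N + 1) H(t)\<close>, where \<open>H\<close> is the
Ehrhart polynomial of the hypersimplex \<open>\<Delta>(k, N + 1)\<close>, and it suffices to study the coefficients of \<open>H\<close>.

By inclusion-exclusion \<open>N! H(t)\<close> is the sum over \<open>j < k\<close> of
\<open>(-1)^j binom(N + 1, j) q_j((k - j) t)\<close> with \<open>q_j(y) = (y - j + 1) \<dots> (y - j + N)\<close>.
The generating function of the \<open>(-1)^j binom(N + 1, j) q_j(y)\<close> in \<open>x\<close> is \<open>N! (1 - x)\<close>
times the coefficient of \<open>v^N\<close> in \<open>(1 - x v)^(y - 1) (1 - v)^(- y - 1)\<close>.  The logarithmic derivative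
of the latter in \<open>v\<close> is the sum of the \<open>(y (1 - x^l) + 1 + x^l) v^(l - 1)\<close>; this recursion shows
that the coefficient of \<open>y^m\<close> is \<open>(1 - x)^m\<close> times a polynomial \<open>w\<close> in \<open>x\<close> with nonnegative coefficients.
The resulting factor \<open>(1 - x)^(m + 1)\<close> turns the series of the \<open>i^m x^i\<close> into the Eulerian polynomial,
so that the coefficient of \<open>t^m\<close> in \<open>H\<close> is a coefficient of a product of two nonnegative polynomials.
\<close>

section \<open>Lattice points\<close>

definition bounded_comps :: "nat \<Rightarrow> nat \<Rightarrow> nat \<Rightarrow> nat list set" where
  "bounded_comps t d M = {xs. length xs = d \<and> (\<forall>x\<in>set xs. x \<le> t) \<and> sum_list xs = M}"

lemma finite_bounded_comps: "finite (bounded_comps t d M)"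
proof -
  have "bounded_comps t d M \<subseteq> {xs. set xs \<subseteq> {..t} \<and> length xs = d}"
    by (auto simp: bounded_comps_def)
  then show ?thesis by (rule finite_subset) (simp add: finite_lists_length_eq)
qed

lemma lattice_points_dilate_panhandle:
  assumes t: "t > 0" and n: "n \<ge> 2"
  shows "dilate (real t) (panhandle_polytope n k) \<inter> integer_points n =
    {x \<in> carrier_vec n. (\<forall>i<n. x $ i \<in> \<int> \<and> x $ i \<ge> 0) \<and> (\<Sum>i<n. x $ i) = real (k * t)
       \<and> (\<forall>i<n - 2. x $ i \<le> real t) \<and> x $ (n - 2) + x $ (n - 1) \<le> real t}" (is "_ = ?R")
proof (intro equalityI subsetI)
  fix x assume "x \<in> dilate (real t) (panhandle_polytope n k) \<inter> integer_points n"
  then obtain p where p: "p \<in> panhandle_polytope n k" "x = real t \<cdot>\<^sub>v p" and int: "x \<in> integer_points n"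
    by (auto simp: dilate_def)
  have *: "x $ i = real t * p $ i" if "i < n" for i
    using p that by (auto simp: panhandle_polytope_def)
  have "real t * (p $ (n - 2) + p $ (n - 1)) \<le> real t * 1"
    using p by (intro mult_left_mono) (auto simp: panhandle_polytope_def)
  moreover have "(\<Sum>i<n. x $ i) = real t * (\<Sum>i<n. p $ i)"
    by (simp add: * sum_distrib_left)
  moreover have "real t * p $ i \<le> real t * 1" if "i < n - 2" for i
    using p that by (intro mult_left_mono) (auto simp: panhandle_polytope_def)
  ultimately show "x \<in> ?R"
    using p int n by (auto simp: panhandle_polytope_def integer_points_def * algebra_simps)
next
  fix x assume x: "x \<in> ?R"
  define p where "p = (1 / real t) \<cdot>\<^sub>v x"
  have *: "p $ i = x $ i / real t" if "i < n" for i
    using x that by (auto simp: p_def)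
  have "x = real t \<cdot>\<^sub>v p"
    using t by (simp add: p_def smult_smult_assoc)
  moreover have "p \<in> panhandle_polytope n k"
    unfolding panhandle_polytope_def
    using x t n by (auto simp: * p_def sum_divide_distrib[symmetric] add_divide_distrib[symmetric])
  ultimately show "x \<in> dilate (real t) (panhandle_polytope n k) \<inter> integer_points n"
    using x by (auto simp: dilate_def integer_points_def)
qed

text \<open>Lattice points are grouped by the sum \<open>s\<close> of the last two coordinates,
  which \<open>s + 1\<close> pairs realise; the other \<open>N\<close> coordinates form a bounded
  composition of the rest.\<close>

lemma card_dilate_panhandle:
  assumes "t > 0" "k > 0"
  shows "card (dilate (real t) (panhandle_polytope (N + 2) k) \<inter> integer_points (N + 2))
     = (\<Sum>s\<le>t. (s + 1) * card (bounded_comps t N (k * t - s)))"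
proof -
  \<comment> \<open>This is where \<open>k > 0\<close> enters: since \<open>s \<le> t\<close>, the
    natural subtraction \<open>k * t - s\<close> never truncates.\<close>
  have tk: "t \<le> k * t" using assms by simp
  let ?S = "SIGMA p:{(a, b). a + b \<le> t}. bounded_comps t N (k * t - (fst p + snd p))"
  let ?f = "\<lambda>((a, b), xs). vec_of_list (map real (xs @ [a, b]))"
  have fin: "finite {(a, b). a + b \<le> t}"
    by (rule finite_subset[of _ "{..t} \<times> {..t}"]) auto
  have inj: "inj_on ?f ?S"
  proof (rule inj_onI)
    fix p q assume *: "p \<in> ?S" "q \<in> ?S" "?f p = ?f q"
    obtain a b xs where p: "p = ((a, b), xs)" by (metis surj_pair)
    obtain a' b' xs' where q: "q = ((a', b'), xs')" by (metis surj_pair)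
    have "list_of_vec (?f p) = list_of_vec (?f q)" using *(3) by simp
    then have "map real (xs @ [a, b]) = map real (xs' @ [a', b'])"
      by (simp only: p q prod.case list_vec)
    then have "xs @ [a, b] = xs' @ [a', b']"
      by (rule map_injective) (simp add: inj_def)
    then show "p = q" using * by (simp add: p q)
  qed
  have "dilate (real t) (panhandle_polytope (N + 2) k) \<inter> integer_points (N + 2) = ?f ` ?S"
    unfolding lattice_points_dilate_panhandle[OF assms(1) le_add2]
  proof (intro equalityI subsetI)
    fix x assume x: "x \<in> {x \<in> carrier_vec (N + 2). (\<forall>i<N + 2. x $ i \<in> \<int> \<and> x $ i \<ge> 0) \<and> (\<Sum>i<N + 2. x $ i) = real (k * t)
       \<and> (\<forall>i<N + 2 - 2. x $ i \<le> real t) \<and> x $ (N + 2 - 2) + x $ (N + 2 - 1) \<le> real t}"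
    define f where "f i = nat \<lfloor>x $ i\<rfloor>" for i
    have f: "x $ i = real (f i)" if "i < N + 2" for i
      using x that by (auto simp: f_def elim!: Ints_cases)
    have sum: "(\<Sum>i<N. f i) + (f N + f (Suc N)) = k * t"
    proof -
      have "real (\<Sum>i<N + 2. f i) = (\<Sum>i<N + 2. x $ i)"
        unfolding of_nat_sum by (rule sum.cong) (auto simp: f)
      also have "\<dots> = real (k * t)" using x by simp
      finally have "(\<Sum>i<N + 2. f i) = k * t" by (simp only: of_nat_eq_iff)
      then show ?thesis by simp
    qed
    have le: "f i \<le> t" if "i < N" for i using x f[of i] that by auto
    have le2: "f N + f (Suc N) \<le> t"
      using x f[of N] f[of "Suc N"] by auto
    have "map f [0..<N] \<in> bounded_comps t N (k * t - (f N + f (Suc N)))"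
      using sum le by (auto simp: bounded_comps_def interv_sum_list_conv_sum_set_nat atLeast0LessThan)
    moreover have "x = ?f ((f N, f (Suc N)), map f [0..<N])"
    proof (rule eq_vecI)
      fix i assume "i < dim_vec (?f ((f N, f (Suc N)), map f [0..<N]))"
      then have "i < N \<or> i = N \<or> i = Suc N" by auto
      then show "x $ i = ?f ((f N, f (Suc N)), map f [0..<N]) $ i"
        by (auto simp: f nth_append vec_of_list_index)
    qed (use x in auto)
    ultimately show "x \<in> ?f ` ?S" using le2 by (intro image_eqI) auto
  next
    fix x assume "x \<in> ?f ` ?S"
    then obtain a b xs where *: "a + b \<le> t" "xs \<in> bounded_comps t N (k * t - (a + b))"
      and x: "x = vec_of_list (map real (xs @ [a, b]))" by auto
    have l: "length xs = N" and le: "\<forall>y\<in>set xs. y \<le> t" and s: "sum_list xs = k * t - (a + b)"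
      using *(2) by (auto simp: bounded_comps_def)
    have nth: "x $ i = real ((xs @ [a, b]) ! i)" if "i < N + 2" for i
      using that l unfolding x vec_of_list_index by (subst nth_map) auto
    have "(\<Sum>i<N + 2. x $ i) = real (sum_list (xs @ [a, b]))"
      unfolding sum_list_sum_nth of_nat_sum by (rule sum.cong) (auto simp: nth l)
    also have "sum_list (xs @ [a, b]) = k * t" using s order_trans[OF *(1) tk] by simp
    finally have sum: "(\<Sum>i<N + 2. x $ i) = real (k * t)" .
    have "x \<in> carrier_vec (N + 2)" by (rule carrier_vecI) (simp add: x l)
    moreover have "x $ i \<in> \<int> \<and> x $ i \<ge> 0" if "i < N + 2" for i
      unfolding nth[OF that] by simp
    moreover have "x $ i \<le> real t" if "i < N" for i
      using nth[of i] that le l by (simp add: nth_append)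
    moreover have "x $ N + x $ Suc N \<le> real t"
      using nth[of N] nth[of "Suc N"] *(1) l by (simp add: nth_append)
    ultimately show "x \<in> {x \<in> carrier_vec (N + 2). (\<forall>i<N + 2. x $ i \<in> \<int> \<and> x $ i \<ge> 0) \<and> (\<Sum>i<N + 2. x $ i) = real (k * t)
       \<and> (\<forall>i<N + 2 - 2. x $ i \<le> real t) \<and> x $ (N + 2 - 2) + x $ (N + 2 - 1) \<le> real t}"
      using sum by (simp del: sum.lessThan_Suc)
  qed
  then have "card (dilate (real t) (panhandle_polytope (N + 2) k) \<inter> integer_points (N + 2)) = card ?S"
    using inj by (simp add: card_image)
  also have "\<dots> = (\<Sum>(a, b)\<in>{(a, b). a + b \<le> t}. card (bounded_comps t N (k * t - (a + b))))"
    using fin by (subst card_SigmaI) (auto simp: finite_bounded_comps case_prod_unfold)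
  also have "\<dots> = (\<Sum>s\<le>t. (s + 1) * card (bounded_comps t N (k * t - s)))"
    \<comment> \<open>The summand depends on \<open>a + b\<close> only, so each diagonal contributes
      \<open>s + 1\<close> equal terms.\<close>
    by (subst sum.triangle_reindex_eq) simp
  finally show ?thesis .
qed

no_notation vec_index (infixl "$" 100)
unbundle fps_syntax

section \<open>Generating functions for the counts\<close>

definition box_fps :: "nat \<Rightarrow> real fps" where
  "box_fps t = Abs_fps (\<lambda>i. of_bool (i \<le> t))"

lemma card_bounded_comps: "real (card (bounded_comps t d M)) = (box_fps t ^ d) $ M"
proof (induction d arbitrary: M)
  case 0
  have "bounded_comps t 0 M = (if M = 0 then {[]} else {})"
    by (auto simp: bounded_comps_def)
  then show ?case by simp
next
  case (Suc d)
  let ?S = "SIGMA s:{s. s \<le> M \<and> s \<le> t}. bounded_comps t d (M - s)"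
  have "bounded_comps t (Suc d) M = (\<lambda>(s, xs). s # xs) ` ?S"
  proof (intro equalityI subsetI)
    fix zs assume "zs \<in> bounded_comps t (Suc d) M"
    then obtain s xs where "zs = s # xs" "(s, xs) \<in> ?S"
      by (cases zs) (auto simp: bounded_comps_def)
    then show "zs \<in> (\<lambda>(s, xs). s # xs) ` ?S" by force
  qed (auto simp: bounded_comps_def)
  then have "card (bounded_comps t (Suc d) M) = card ?S"
    by (simp add: card_image inj_on_def)
  also have "\<dots> = (\<Sum>s | s \<le> M \<and> s \<le> t. card (bounded_comps t d (M - s)))"
    by (simp add: finite_bounded_comps)
  finally have "real (card (bounded_comps t (Suc d) M))
      = (\<Sum>s | s \<le> M \<and> s \<le> t. (box_fps t ^ d) $ (M - s))"
    by (simp add: Suc)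
  also have "\<dots> = (\<Sum>s\<in>{0..M}. if s \<le> t then (box_fps t ^ d) $ (M - s) else 0)"
    by (rule sum.mono_neutral_cong_left) auto
  also have "\<dots> = (box_fps t ^ Suc d) $ M"
    unfolding power_Suc fps_mult_nth by (rule sum.cong) (auto simp: box_fps_def)
  finally show ?case .
qed

lemma panhandle_count_eq:
  assumes "t > 0" "k > 0"
  shows "(real N + 1) * real (card (dilate (real t) (panhandle_polytope (N + 2) k) \<inter> integer_points (N + 2)))
     = (real k * real t + real N + 1) * (box_fps t ^ Suc N) $ (k * t)"
proof -
  define P where "P = box_fps t"
  \<comment> \<open>\<open>Q\<close> is the derivative of \<open>fps_X * P\<close>, so its
    coefficients are the weights \<open>s + 1\<close> for \<open>s \<le> t\<close>.\<close>
  define Q where "Q = P + fps_X * fps_deriv P"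
  have Q: "Q $ s = (if s \<le> t then real s + 1 else 0)" for s
    by (cases s) (auto simp: Q_def P_def box_fps_def)
  have tk: "t \<le> k * t" using assms by simp
  have "(Q * P ^ N) $ (k * t) = (\<Sum>s\<in>{0..k * t}. if s \<le> t then (real s + 1) * (P ^ N) $ (k * t - s) else 0)"
    by (auto simp: fps_mult_nth Q intro!: sum.cong)
  also have "\<dots> = (\<Sum>s\<le>t. (real s + 1) * (P ^ N) $ (k * t - s))"
    by (intro sum.mono_neutral_cong_right) (auto intro: order_trans[OF _ tk])
  finally have count: "real (card (dilate (real t) (panhandle_polytope (N + 2) k) \<inter> integer_points (N + 2)))
      = (Q * P ^ N) $ (k * t)"
    unfolding card_dilate_panhandle[OF assms] by (simp add: card_bounded_comps P_def distrib_right add.commute)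
  have deriv: "fps_deriv (P ^ Suc N) = fps_const (real N + 1) * fps_deriv P * P ^ N"
    using fps_deriv_power[of P "Suc N"] by (simp add: add.commute del: power_Suc)
  have "fps_const (real N + 1) * (Q * P ^ N)
      = fps_const (real N + 1) * P ^ Suc N + fps_X * fps_deriv (P ^ Suc N)"
    unfolding deriv Q_def by (simp add: algebra_simps del: fps_const_add)
  then have "(real N + 1) * (Q * P ^ N) $ (k * t)
      = (real N + 1) * (P ^ Suc N) $ (k * t) + (fps_X * fps_deriv (P ^ Suc N)) $ (k * t)"
    by (metis fps_add_nth fps_mult_left_const_nth)
  also have "(fps_X * fps_deriv (P ^ Suc N)) $ (k * t) = real (k * t) * (P ^ Suc N) $ (k * t)"
    using assms by (cases "k * t") (simp_all del: power_Suc)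
  finally show ?thesis unfolding count by (simp add: P_def algebra_simps)
qed

section \<open>Refined weighted Lah numbers\<close>

lemma fps_geometric_mult: "(1 - fps_const c * fps_X) * Abs_fps (\<lambda>i. c ^ i) = (1 :: real fps)"
proof (rule fps_ext)
  fix i
  show "((1 - fps_const c * fps_X) * Abs_fps (\<lambda>i. c ^ i)) $ i = (1 :: real fps) $ i"
    by (cases i) (simp_all add: left_diff_distrib mult.assoc)
qed

text \<open>\<open>B\<close> is the binomial series of \<open>(1 - c X)^(-z)\<close>, with
  logarithmic derivative \<open>z c / (1 - c X)\<close>. Coefficients are compared in
  \<open>(1 - c X) B' = z c B\<close>, and the factor \<open>1 - c X\<close> is then cancelled by
  the geometric series.\<close>

lemma fps_deriv_pochhammer:
  fixes c z :: real
  defines "B \<equiv> Abs_fps (\<lambda>i. pochhammer z i / fact i * c ^ i)"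
  shows "fps_deriv B = B * Abs_fps (\<lambda>i. z * c ^ Suc i)"
proof -
  have *: "(1 - fps_const c * fps_X) * fps_deriv B = fps_const (z * c) * B"
  proof (rule fps_ext)
    fix i
    have "((1 - fps_const c * fps_X) * fps_deriv B) $ i
        = fps_deriv B $ i - c * (fps_X * fps_deriv B) $ i"
      by (simp add: left_diff_distrib mult.assoc)
    also have "\<dots> = (fps_const (z * c) * B) $ i"
      by (cases i) (simp_all add: B_def pochhammer_Suc field_simps del: of_nat_Suc)
    finally show "((1 - fps_const c * fps_X) * fps_deriv B) $ i = (fps_const (z * c) * B) $ i" .
  qed
  have "fps_deriv B = ((1 - fps_const c * fps_X) * Abs_fps (\<lambda>i. c ^ i)) * fps_deriv B"
    by (simp only: fps_geometric_mult mult_1)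
  also have "\<dots> = B * (fps_const (z * c) * Abs_fps (\<lambda>i. c ^ i))"
    using * by (simp add: ac_simps)
  also have "fps_const (z * c) * Abs_fps (\<lambda>i. c ^ i) = Abs_fps (\<lambda>i. z * c ^ Suc i)"
    by (rule fps_ext) (simp add: mult.assoc)
  finally show ?thesis .
qed

text \<open>The coefficient of \<open>v^N\<close> in \<open>(1 - x v)^(y - 1) (1 - v)^(- y - 1)\<close>.\<close>

definition lah_sum :: "nat \<Rightarrow> real \<Rightarrow> real \<Rightarrow> real" where
  "lah_sum N x y = (\<Sum>i\<le>N. pochhammer (1 - y) i / fact i * x ^ i * (pochhammer (1 + y) (N - i) / fact (N - i)))"

lemma lah_sum_0: "lah_sum 0 x y = 1"
  by (simp add: lah_sum_def)

lemma lah_sum_Suc: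
  "(real N + 1) * lah_sum (Suc N) x y
     = (\<Sum>l\<le>N. (y * (1 - x ^ Suc l) + 1 + x ^ Suc l) * lah_sum (N - l) x y)"
proof -
  define B where "B = Abs_fps (\<lambda>i. pochhammer (1 - y) i / fact i * x ^ i)"
  define D where "D = Abs_fps (\<lambda>i. pochhammer (1 + y) i / fact i * 1 ^ i)"
  have nth: "(B * D) $ N = lah_sum N x y" for N
    by (simp add: fps_mult_nth B_def D_def lah_sum_def atMost_atLeast0)
  have B: "fps_deriv B = B * Abs_fps (\<lambda>i. (1 - y) * x ^ Suc i)"
    unfolding B_def by (rule fps_deriv_pochhammer)
  have D: "fps_deriv D = D * Abs_fps (\<lambda>i. (1 + y) * 1 ^ Suc i)"
    unfolding D_def by (rule fps_deriv_pochhammer)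
  have "fps_deriv (B * D) = B * D * Abs_fps (\<lambda>i. (1 - y) * x ^ Suc i) + B * D * Abs_fps (\<lambda>i. (1 + y) * 1 ^ Suc i)"
    by (simp only: B D fps_deriv_mult ac_simps)
  also have "\<dots> = Abs_fps (\<lambda>i. y * (1 - x ^ Suc i) + 1 + x ^ Suc i) * (B * D)"
    unfolding distrib_left[symmetric] mult.commute[of _ "B * D"]
    by (rule arg_cong[where f = "(*) (B * D)"]) (auto intro!: fps_ext simp: algebra_simps)
  finally have "fps_deriv (B * D) $ N = (Abs_fps (\<lambda>i. y * (1 - x ^ Suc i) + 1 + x ^ Suc i) * (B * D)) $ N"
    by simp
  then show ?thesis
    unfolding fps_deriv_nth fps_mult_nth[of "Abs_fps _"]
    by (simp add: nth atMost_atLeast0 add.commute)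
qed

text \<open>The factors \<open>y - q, ..., y + r\<close> are split at \<open>y\<close>; reversing
  the sign of the \<open>q\<close> factors below \<open>y\<close> gives
  \<open>pochhammer (1 - y) q\<close>.\<close>

lemma pochhammer_shift:
  fixes y :: real
  shows "(-1) ^ Suc q * pochhammer (y - real q) (Suc (q + r)) = - pochhammer (1 - y) q * y * pochhammer (1 + y) r"
proof -
  have "pochhammer (y - real q) (q + Suc r) = pochhammer (y - real q) q * pochhammer y (Suc r)"
    using pochhammer_product'[of "y - real q" q "Suc r"] by simp
  moreover have "pochhammer (1 - y) q = (-1) ^ q * pochhammer (y - real q) q"
    using pochhammer_minus[of "y - 1" q] by (simp add: algebra_simps)
  ultimately show ?thesis
    by (simp add: pochhammer_rec algebra_simps)
qed

text \<open>With \<open>G i\<close> the coefficient of \<open>x^i\<close> in \<open>lah_sum\<close>,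
  multiplication by \<open>1 - x\<close> produces the differences \<open>G j - G (j - 1)\<close>. So
  it suffices to match these with the terms \<open>T j\<close>, the two ends \<open>j = 0\<close>
  and \<open>j = N + 1\<close> separately.\<close>

lemma lah_sum_eq:
  "(\<Sum>j\<le>Suc N. x ^ j * ((-1) ^ j * real (Suc N choose j) * pochhammer (y - real j + 1) N))
     = fact N * (1 - x) * lah_sum N x y"
proof -
  define G where "G i = pochhammer (1 - y) i / fact i * (pochhammer (1 + y) (N - i) / fact (N - i))" for i
  define T where "T j = (-1) ^ j * real (Suc N choose j) * pochhammer (y - real j + 1) N" for j
  have L: "lah_sum N x y = (\<Sum>i\<le>N. x ^ i * G i)"
    by (simp add: lah_sum_def G_def ac_simps)
  have T0: "T 0 = fact N * G 0"
    by (simp add: T_def G_def add.commute)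
  have TN: "T (Suc N) = - (fact N * G N)"
    using pochhammer_minus[of "y - 1" N] by (simp add: T_def G_def algebra_simps)
  have TS: "T (Suc q) = fact N * (G (Suc q) - G q)" if q: "q < N" for q
  proof -
    obtain r where N: "N = Suc (q + r)" using less_imp_Suc_add[OF q] by auto
    have c: "real (Suc N choose Suc q) = fact N * real (N + 1) / (fact (Suc q) * fact (Suc r))"
      by (subst binomial_fact) (auto simp: N simp del: fact_Suc, simp add: algebra_simps)
    have p: "(-1) ^ Suc q * pochhammer (y - real q) N = - pochhammer (1 - y) q * y * pochhammer (1 + y) r"
      unfolding N by (rule pochhammer_shift)
    have "T (Suc q) = real (Suc N choose Suc q) * ((-1) ^ Suc q * pochhammer (y - real q) N)"
      by (simp add: T_def)
    \<comment> \<open>Over a common denominator the identity reduces to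
      \<open>(q + 1 - y) (r + 1) - (r + 1 + y) (q + 1) = - y (N + 1)\<close>.\<close>
    also have "\<dots> = fact N * (G (Suc q) - G q)"
      unfolding c p unfolding G_def N
      by (simp add: pochhammer_Suc divide_simps) (simp add: algebra_simps)
    finally show ?thesis .
  qed
  have "(\<Sum>j\<le>Suc N. x ^ j * T j) = T 0 + (\<Sum>q<N. x ^ Suc q * T (Suc q)) + x ^ Suc N * T (Suc N)"
    by (subst sum.atMost_Suc) (simp add: sum.atMost_shift)
  also have "\<dots> = fact N * (G 0 + (\<Sum>q<N. x ^ Suc q * G (Suc q)) - x * ((\<Sum>q<N. x ^ q * G q) + x ^ N * G N))"
  proof -
    have "(\<Sum>q<N. x ^ Suc q * T (Suc q)) = (\<Sum>q<N. fact N * (x ^ Suc q * G (Suc q)) - fact N * (x * (x ^ q * G q)))"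
      by (rule sum.cong) (simp_all add: TS algebra_simps)
    also have "\<dots> = fact N * (\<Sum>q<N. x ^ Suc q * G (Suc q)) - fact N * (x * (\<Sum>q<N. x ^ q * G q))"
      by (simp only: sum_subtractf sum_distrib_left)
    finally have *: "(\<Sum>q<N. x ^ Suc q * T (Suc q))
        = fact N * (\<Sum>q<N. x ^ Suc q * G (Suc q)) - fact N * (x * (\<Sum>q<N. x ^ q * G q))" .
    show ?thesis
      unfolding T0 TN * by (simp add: algebra_simps)
  qed
  also have "G 0 + (\<Sum>q<N. x ^ Suc q * G (Suc q)) = lah_sum N x y"
    by (simp add: L sum.atMost_shift)
  also have "(\<Sum>q<N. x ^ q * G q) + x ^ N * G N = lah_sum N x y"
    by (simp add: L lessThan_Suc_atMost[symmetric])
  also have "fact N * (lah_sum N x y - x * lah_sum N x y) = fact N * (1 - x) * lah_sum N x y"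
    by (simp add: algebra_simps)
  finally show ?thesis unfolding T_def .
qed

text \<open>The polynomials \<open>w\<close>.  In the recursion for \<open>lah_sum\<close>, \<open>y (1 - x^(l+1))\<close> is \<open>y (1 - x)\<close> times
\<open>1 + x + \<dots> + x^l\<close>: the first factor raises \<open>m\<close> by one, and the second one stays.\<close>

fun lah_poly :: "nat \<Rightarrow> nat \<Rightarrow> real poly" where
  "lah_poly 0 m = (if m = 0 then 1 else 0)"
| "lah_poly (Suc N) m = smult (1 / (real N + 1)) (\<Sum>l\<le>N.
     (if m = 0 then 0 else (\<Sum>i\<le>l. monom 1 i) * lah_poly (N - l) (m - 1))
     + (1 + monom 1 (Suc l)) * lah_poly (N - l) m)"

text \<open>The upper limit \<open>M\<close> is left free because the induction hypothesis is used
  both for \<open>M\<close> and, after the index shift in \<open>m\<close>, for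
  \<open>M - 1\<close>.\<close>

lemma lah_sum_eq_lah_poly:
  "M \<ge> N \<Longrightarrow> lah_sum N x y = (\<Sum>m\<le>M. y ^ m * ((1 - x) ^ m * poly (lah_poly N m) x))"
proof (induction N arbitrary: M rule: less_induct)
  case (less N)
  show ?case
  proof (cases N)
    case 0
    have "(\<Sum>m\<le>M. y ^ m * ((1 - x) ^ m * poly (lah_poly 0 m) x)) = (\<Sum>m\<le>M. if m = 0 then 1 else 0)"
      by (rule sum.cong) auto
    then show ?thesis using 0 by (simp add: lah_sum_0)
  next
    case (Suc K)
    define S where "S p = (\<Sum>m\<le>M. y ^ m * ((1 - x) ^ m * p m))" for p :: "nat \<Rightarrow> real"
    obtain M' where M': "M = Suc M'" using less.prems Suc by (cases M) auto
    have shift: "S (\<lambda>m. if m = 0 then 0 else p (m - 1)) = y * (1 - x) * (\<Sum>m\<le>M'. y ^ m * ((1 - x) ^ m * p m))" for p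
      unfolding S_def M' by (subst sum.atMost_Suc_shift) (simp add: sum_distrib_left ac_simps)
    have step: "S (\<lambda>m. (if m = 0 then 0 else (\<Sum>i\<le>l. x ^ i) * poly (lah_poly (K - l) (m - 1)) x)
                 + (1 + x ^ Suc l) * poly (lah_poly (K - l) m) x)
        = (y * (1 - x ^ Suc l) + 1 + x ^ Suc l) * lah_sum (K - l) x y" for l
    proof -
      have "S (\<lambda>m. (if m = 0 then 0 else (\<Sum>i\<le>l. x ^ i) * poly (lah_poly (K - l) (m - 1)) x)
                 + (1 + x ^ Suc l) * poly (lah_poly (K - l) m) x)
          = (\<Sum>i\<le>l. x ^ i) * S (\<lambda>m. if m = 0 then 0 else poly (lah_poly (K - l) (m - 1)) x)
            + (1 + x ^ Suc l) * S (\<lambda>m. poly (lah_poly (K - l) m) x)"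
        unfolding S_def sum_distrib_left sum.distrib[symmetric]
        by (rule sum.cong) (auto simp: algebra_simps)
      also have "S (\<lambda>m. if m = 0 then 0 else poly (lah_poly (K - l) (m - 1)) x) = y * (1 - x) * lah_sum (K - l) x y"
        unfolding shift[of "\<lambda>m. poly (lah_poly (K - l) m) x"] using less.prems Suc M' by (subst less.IH[of "K - l" M']) auto
      also have "S (\<lambda>m. poly (lah_poly (K - l) m) x) = lah_sum (K - l) x y"
        unfolding S_def using less.prems Suc by (subst less.IH[of "K - l" M]) auto
      also have "(\<Sum>i\<le>l. x ^ i) * (y * (1 - x) * lah_sum (K - l) x y) = y * ((1 - x) * (\<Sum>i\<le>l. x ^ i)) * lah_sum (K - l) x y"
        by simp
      also have "(1 - x) * (\<Sum>i\<le>l. x ^ i) = 1 - x ^ Suc l"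
        using one_diff_power_eq[of x "Suc l"] by (simp only: lessThan_Suc_atMost)
      finally show ?thesis by (simp only: algebra_simps)
    qed
    have rec: "(real K + 1) * poly (lah_poly N m) x
        = (\<Sum>l\<le>K. (if m = 0 then 0 else (\<Sum>i\<le>l. x ^ i) * poly (lah_poly (K - l) (m - 1)) x)
                 + (1 + x ^ Suc l) * poly (lah_poly (K - l) m) x)" for m
      unfolding Suc lah_poly.simps poly_smult poly_sum
      by (cases "m = 0") (simp_all add: poly_sum poly_monom)
    have "(real K + 1) * S (\<lambda>m. poly (lah_poly N m) x) = S (\<lambda>m. (real K + 1) * poly (lah_poly N m) x)"
      by (simp add: S_def sum_distrib_left ac_simps)
    also have "\<dots> = (\<Sum>l\<le>K. S (\<lambda>m. (if m = 0 then 0 else (\<Sum>i\<le>l. x ^ i) * poly (lah_poly (K - l) (m - 1)) x)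
                 + (1 + x ^ Suc l) * poly (lah_poly (K - l) m) x))"
      unfolding rec unfolding S_def sum_distrib_left by (rule sum.swap)
    also have "\<dots> = (real K + 1) * lah_sum N x y"
      unfolding step Suc by (rule lah_sum_Suc[symmetric])
    finally show ?thesis by (simp add: S_def)
  qed
qed

lemma coeff_mult_nonneg:
  fixes p q :: "real poly"
  assumes "\<And>i. coeff p i \<ge> 0" "\<And>i. coeff q i \<ge> 0"
  shows "coeff (p * q) i \<ge> 0"
  using assms by (auto simp: coeff_mult intro!: sum_nonneg)

lemma lah_poly_nonneg: "coeff (lah_poly N m) i \<ge> 0"
proof (induction N m arbitrary: i rule: lah_poly.induct)
  case (2 N m)
  show ?case
    unfolding lah_poly.simps coeff_smult coeff_sum coeff_add
    by (intro mult_nonneg_nonneg sum_nonneg add_nonneg_nonneg)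
       (auto intro!: coeff_mult_nonneg sum_nonneg 2[simplified] simp: coeff_sum)
qed auto

text \<open>All summands of the recursion are nonnegative, so \<open>l = 0\<close> suffices. For
  \<open>m > 0\<close> it contains \<open>lah_poly N (m - 1)\<close>, whose range of positive
  coefficients is already the right one; for \<open>m = 0\<close> the factor \<open>1 + x\<close>
  lengthens the range by one.\<close>

lemma lah_poly_pos:
  assumes "m \<le> N" "i \<le> N - m"
  shows "coeff (lah_poly N m) i > 0"
  using assms
proof (induction N arbitrary: m i)
  case (Suc N)
  define T where "T l = (if m = 0 then 0 else (\<Sum>i\<le>l. monom 1 i) * lah_poly (N - l) (m - 1))
     + (1 + monom 1 (Suc l)) * lah_poly (N - l) m" for l
  have "coeff (T l) i \<ge> 0" for l
    unfolding T_def coeff_add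
    by (intro add_nonneg_nonneg)
       (auto intro!: coeff_mult_nonneg sum_nonneg lah_poly_nonneg simp: coeff_sum)
  moreover have "coeff (T 0) i > 0"
  proof (cases "m = 0")
    case True
    have "coeff (T 0) i = coeff (lah_poly N 0) i + (if i = 0 then 0 else coeff (lah_poly N 0) (i - 1))"
      by (cases i) (auto simp: T_def True distrib_right coeff_monom_mult)
    moreover have "(if i = 0 then 0 else coeff (lah_poly N 0) (i - 1)) \<ge> 0"
      by (simp add: lah_poly_nonneg)
    moreover have "coeff (lah_poly N 0) i > 0 \<or> i > 0 \<and> coeff (lah_poly N 0) (i - 1) > 0"
      using Suc.IH[of 0 i] Suc.IH[of 0 "i - 1"] Suc.prems True by (cases "i \<le> N") auto
    ultimately show ?thesis using lah_poly_nonneg[of N 0 i] by (auto split: if_splits)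
  next
    case False
    have "coeff ((1 + monom 1 (Suc 0)) * lah_poly N m) i \<ge> 0"
      by (intro coeff_mult_nonneg) (auto simp: lah_poly_nonneg)
    moreover have "coeff (lah_poly N (m - 1)) i > 0"
      using Suc.prems False by (intro Suc.IH) auto
    ultimately show ?thesis using False by (simp add: T_def monom_0)
  qed
  ultimately have "(\<Sum>l\<le>N. coeff (T l) i) > 0"
    by (intro sum_pos2[of _ 0]) auto
  then show ?case by (simp add: T_def coeff_sum)
qed auto

section \<open>Eulerian numbers\<close>

text \<open>For \<open>m \<ge> 1\<close> these are the Eulerian numbers counting permutations of
  \<open>m\<close> elements with \<open>i - 1\<close> descents. For \<open>m = 0\<close> the
  generating polynomial is \<open>x\<close>, not \<open>1\<close>.\<close>

fun euler_num :: "nat \<Rightarrow> nat \<Rightarrow> real" where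
  "euler_num 0 i = of_bool (i = 1)"
| "euler_num (Suc m) i = real i * euler_num m i
     + (if i = 0 then 0 else (real m + 2 - real i) * euler_num m (i - 1))"

lemma euler_num_eq_0: "i > m + 1 \<Longrightarrow> euler_num m i = 0"
  by (induction m arbitrary: i) auto

lemma euler_num_nonneg: "euler_num m i \<ge> 0"
proof (induction m arbitrary: i)
  case (Suc m)
  \<comment> \<open>The first factor is negative only for \<open>i > m + 2\<close>, and there the
    second one vanishes.\<close>
  have "(real m + 2 - real i) * euler_num m (i - 1) \<ge> 0"
    using Suc euler_num_eq_0[of m "i - 1"] by (cases "i \<le> m + 2") auto
  then show ?case using Suc by simp
qed auto

lemma euler_num_pos: "1 \<le> i \<Longrightarrow> i \<le> max m 1 \<Longrightarrow> euler_num m i > 0"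
proof (induction m arbitrary: i)
  case (Suc m)
  show ?case
  proof (cases "i \<le> max m 1")
    case True
    have "real i * euler_num m i > 0" using Suc.IH[of i] True Suc.prems by simp
    moreover have "(real m + 2 - real i) * euler_num m (i - 1) \<ge> 0"
      using Suc.prems euler_num_nonneg by simp
    ultimately show ?thesis using Suc.prems by simp
  next
    case False
    \<comment> \<open>At the new top index the factor \<open>m + 2 - i\<close> equals 1, so
      positivity is inherited from \<open>euler_num m m\<close>.\<close>
    then have i: "i = Suc m" "m \<ge> 1" using Suc.prems by auto
    then have "euler_num m m > 0" using Suc.IH by simp
    moreover have "real i * euler_num m i \<ge> 0" using euler_num_nonneg by simp
    ultimately show ?thesis using i by simp
  qed
qed auto

text \<open>The case distinction at \<open>i = 0\<close> excludes \<open>0 ^ 0 = 1\<close> when \<open>m = 0\<close>.\<close>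

lemma euler_num_fps:
  "Abs_fps (euler_num m) = (1 - fps_X) ^ Suc m * Abs_fps (\<lambda>i. if i = 0 then 0 else real i ^ m)"
proof (induction m)
  case 0
  have "((1 - fps_X) * Abs_fps (\<lambda>i. if i = 0 then 0 else real i ^ 0)) $ i = euler_num 0 i" for i
    by (cases i) (auto simp: left_diff_distrib)
  then show ?case by (simp add: fps_eq_iff)
next
  case (Suc m)
  define S where "S = Abs_fps (\<lambda>i. if i = 0 then 0 else real i ^ m)"
  define A where "A = Abs_fps (euler_num m)"
  have A: "A = (1 - fps_X) ^ Suc m * S" using Suc by (simp add: A_def S_def)
  have S: "Abs_fps (\<lambda>i. if i = 0 then 0 else real i ^ Suc m) = fps_X * fps_deriv S"
    by (rule fps_ext) (auto simp: S_def)
  define c where "c = (of_nat (Suc m) :: real fps)"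
  have c: "c = fps_const (real m + 1)"
    unfolding c_def fps_of_nat[symmetric] by (simp add: add.commute)
  have "fps_deriv ((1 - fps_X :: real fps) ^ Suc m) = - (c * (1 - fps_X) ^ m)"
    unfolding fps_deriv_power' by (simp add: c_def del: of_nat_Suc)
  then have dA: "fps_deriv A = (1 - fps_X) ^ Suc m * fps_deriv S - c * (1 - fps_X) ^ m * S"
    unfolding A fps_deriv_mult by simp
  \<comment> \<open>The Eulerian recursion \<open>A_(m+1) = x (1 - x) A_m' + (m + 1) x A_m\<close>:
    the \<open>S\<close> terms on the right cancel.\<close>
  have "(1 - fps_X) ^ Suc (Suc m) * (fps_X * fps_deriv S)
      = fps_X * (1 - fps_X) * fps_deriv A + c * (fps_X * A)"
    unfolding dA unfolding A by (simp add: algebra_simps)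
  also have "\<dots> = Abs_fps (euler_num (Suc m))"
  proof (rule fps_ext)
    fix i
    have "(fps_X * (1 - fps_X) * fps_deriv A + c * (fps_X * A)) $ i
      = (fps_X * fps_deriv A) $ i - (fps_X * (fps_X * fps_deriv A)) $ i + (real m + 1) * (fps_X * A) $ i"
      unfolding c fps_add_nth fps_mult_left_const_nth by (simp add: algebra_simps)
    also have "\<dots> = euler_num (Suc m) i"
    proof (cases i)
      case (Suc j)
      then show ?thesis by (cases j) (auto simp: A_def algebra_simps)
    qed simp
    finally show "(fps_X * (1 - fps_X) * fps_deriv A + c * (fps_X * A)) $ i
      = Abs_fps (euler_num (Suc m)) $ i" by simp
  qed
  finally show ?case by (simp only: S)
qed

section \<open>Coefficients of the hypersimplex polynomial\<close>

definition pochhammer_poly :: "nat \<Rightarrow> nat \<Rightarrow> real poly" where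
  "pochhammer_poly N j = (\<Prod>i<N. [:1 - real j + real i, 1:])"

lemma poly_pochhammer_poly: "poly (pochhammer_poly N j) y = pochhammer (y - real j + 1) N"
  by (auto simp: pochhammer_poly_def poly_prod pochhammer_prod atLeast0LessThan intro!: prod.cong)

definition hyp_coeff :: "nat \<Rightarrow> nat \<Rightarrow> nat \<Rightarrow> real" where
  "hyp_coeff N m j = (-1) ^ j * real (Suc N choose j) * coeff (pochhammer_poly N j) m"

text \<open>An identity in two variables, treated one at a time: for fixed \<open>x\<close> both
  sides are polynomials in \<open>y\<close>, whose coefficients at \<open>m\<close> are compared;
  the result holds for all \<open>x\<close> and so is an identity of polynomials in
  \<open>x\<close>.\<close>

lemma hyp_coeff_fps:
  "Abs_fps (hyp_coeff N m) = fps_const (fact N) * (1 - fps_X) ^ Suc m * fps_of_poly (lah_poly N m)"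
proof -
  define p where "p = (\<Sum>j\<le>Suc N. monom (hyp_coeff N m j) j)"
  define q where "q = smult (fact N) ([:1, -1:] ^ Suc m * lah_poly N m)"
  have "poly p x = poly q x" for x
  proof -
    define P where "P = (\<Sum>j\<le>Suc N. smult (x ^ j * ((-1) ^ j * real (Suc N choose j))) (pochhammer_poly N j))"
    \<comment> \<open>The limit \<open>N + m\<close> keeps the index \<open>m\<close> in range even
      for \<open>m > N\<close>.\<close>
    define Q where "Q = (\<Sum>i\<le>N + m. monom (fact N * (1 - x) ^ Suc i * poly (lah_poly N i) x) i)"
    have "poly P y = poly Q y" for y
    proof -
      have "poly P y = fact N * (1 - x) * lah_sum N x y"
        unfolding lah_sum_eq[symmetric] by (simp add: P_def poly_sum poly_pochhammer_poly mult.assoc)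
      also have "\<dots> = poly Q y"
        unfolding lah_sum_eq_lah_poly[OF le_add1[of N m]]
        by (simp add: Q_def poly_sum poly_monom sum_distrib_left ac_simps)
      finally show ?thesis .
    qed
    then have "P = Q" by (simp add: poly_eq_poly_eq_iff[symmetric] fun_eq_iff)
    then have "coeff P m = coeff Q m" by simp
    moreover have "coeff P m = poly p x"
      by (simp add: P_def p_def coeff_sum poly_sum poly_monom hyp_coeff_def ac_simps)
    moreover have "coeff Q m = poly q x"
      by (simp add: Q_def q_def coeff_sum poly_power left_diff_distrib)
    ultimately show ?thesis by simp
  qed
  then have "p = q" by (simp add: poly_eq_poly_eq_iff[symmetric] fun_eq_iff)
  moreover have "fps_of_poly p = Abs_fps (hyp_coeff N m)"
  proof (rule fps_ext)
    fix j
    have "coeff p j = (if j \<le> Suc N then hyp_coeff N m j else 0)"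
      by (simp add: p_def coeff_sum)
    then show "fps_of_poly p $ j = Abs_fps (hyp_coeff N m) $ j"
      by (auto simp: hyp_coeff_def)
  qed
  moreover have "fps_of_poly q = fps_const (fact N) * (1 - fps_X) ^ Suc m * fps_of_poly (lah_poly N m)"
  proof -
    have "fps_of_poly [:1, -1:] = (1 - fps_X :: real fps)"
      by (simp add: fps_of_poly_pCons flip: fps_const_neg)
    then show ?thesis
      by (simp add: q_def fps_of_poly_smult fps_of_poly_mult fps_of_poly_power mult.assoc del: power_Suc)
  qed
  ultimately show ?thesis by simp
qed

text \<open>For \<open>1 \<le> k \<le> N + 1\<close> this is \<open>N!\<close> times the Ehrhart
  polynomial of the hypersimplex \<open>\<Delta>(k, N + 1)\<close>.\<close>

definition hyp_poly :: "nat \<Rightarrow> nat \<Rightarrow> real poly" where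
  "hyp_poly N k = (\<Sum>j<k. smult ((-1) ^ j * real (Suc N choose j)) (pcompose (pochhammer_poly N j) [:0, real (k - j):]))"

lemma coeff_hyp_poly:
  "coeff (hyp_poly N k) m = fact N * (\<Sum>i\<le>k. euler_num m i * coeff (lah_poly N m) (k - i))"
proof -
  let ?S = "Abs_fps (\<lambda>i. if i = 0 then 0 else real i ^ m)"
  have "coeff (hyp_poly N k) m = (\<Sum>j<k. hyp_coeff N m j * real (k - j) ^ m)"
    by (simp add: hyp_poly_def coeff_sum coeff_pcompose_linear hyp_coeff_def ac_simps)
  \<comment> \<open>The added term \<open>j = k\<close> is zero for \<open>m = 0\<close> too, since
    \<open>?S\<close> has constant term 0.\<close>
  also have "\<dots> = (\<Sum>j\<in>{0..k}. hyp_coeff N m j * ?S $ (k - j))"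
    by (rule sum.mono_neutral_cong_left) auto
  also have "\<dots> = (Abs_fps (hyp_coeff N m) * ?S) $ k"
    by (simp add: fps_mult_nth)
  also have "Abs_fps (hyp_coeff N m) * ?S = fps_const (fact N) * (Abs_fps (euler_num m) * fps_of_poly (lah_poly N m))"
    unfolding hyp_coeff_fps euler_num_fps by (simp only: ac_simps)
  also have "\<dots> $ k = fact N * (\<Sum>i\<le>k. euler_num m i * coeff (lah_poly N m) (k - i))"
    unfolding fps_mult_left_const_nth by (simp add: fps_mult_nth atMost_atLeast0)
  finally show ?thesis .
qed

lemma coeff_hyp_poly_nonneg: "coeff (hyp_poly N k) m \<ge> 0"
  by (auto simp: coeff_hyp_poly intro!: mult_nonneg_nonneg sum_nonneg euler_num_nonneg lah_poly_nonneg)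

lemma coeff_hyp_poly_pos:
  assumes "1 \<le> k" "m \<le> N" "k \<le> N \<or> k = Suc N \<and> m = 0"
  shows "coeff (hyp_poly N k) m > 0"
proof -
  \<comment> \<open>The largest index up to \<open>k\<close> at which \<open>euler_num_pos\<close>
    applies; it makes \<open>k - i\<close> small enough for \<open>lah_poly_pos\<close>, that is
    \<open>k - i \<le> N - m\<close>.\<close>
  define i where "i = min k (max m 1)"
  have "euler_num m i > 0" "coeff (lah_poly N m) (k - i) > 0"
    using assms by (auto simp: i_def intro!: euler_num_pos lah_poly_pos)
  then have "(\<Sum>i\<le>k. euler_num m i * coeff (lah_poly N m) (k - i)) > 0"
    by (intro sum_pos2[of _ i]) (auto simp: i_def euler_num_nonneg lah_poly_nonneg)
  then show ?thesis by (simp add: coeff_hyp_poly)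
qed

section \<open>Ehrhart polynomials\<close>

text \<open>The finite geometric sum is \<open>(1 - z^(t+1)) / (1 - z)\<close>, and
  \<open>(1 - z)^(-N-1)\<close> is the negative binomial series.\<close>

lemma box_fps_power:
  "box_fps t ^ Suc N = (1 - fps_X ^ Suc t) ^ Suc N * Abs_fps (\<lambda>i. real ((N + i) choose N))"
proof -
  have "(1 - fps_X) * box_fps t = 1 - fps_X ^ Suc t"
  proof (rule fps_ext)
    fix i show "((1 - fps_X) * box_fps t) $ i = (1 - fps_X ^ Suc t) $ i"
      by (cases i) (auto simp: left_diff_distrib box_fps_def fps_X_power_nth simp del: power_Suc)
  qed
  then have *: "(1 - fps_X) ^ Suc N * box_fps t ^ Suc N = (1 - fps_X ^ Suc t) ^ Suc N"
    by (metis power_mult_distrib)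
  have "inverse ((1 - fps_X) ^ Suc N :: real fps) = Abs_fps (\<lambda>i. real ((N + i) choose i))"
    using one_minus_const_fps_X_neg_power'[of "Suc N" "1 :: real"] by simp
  also have "\<dots> = Abs_fps (\<lambda>i. real ((N + i) choose N))"
    by (metis add_diff_cancel_left' binomial_symmetric le_add1)
  finally have "Abs_fps (\<lambda>i. real ((N + i) choose N)) = inverse ((1 - fps_X) ^ Suc N)" ..
  moreover have "inverse ((1 - fps_X) ^ Suc N) * (1 - fps_X) ^ Suc N = (1 :: real fps)"
    by (rule inverse_mult_eq_1) simp
  ultimately show ?thesis
    unfolding *[symmetric] by (metis mult.commute mult.left_commute mult_1_right)
qed

lemma pochhammer_of_nat_eq: "pochhammer (real u + 1) N = fact N * real ((N + u) choose N)"
proof -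
  have "real ((N + u) choose N) = pochhammer (real u + 1) N / fact N"
    by (simp add: binomial_gbinomial gbinomial_pochhammer' algebra_simps)
  then show ?thesis by simp
qed

text \<open>Inclusion-exclusion keeps the \<open>j\<close> with \<open>j (t + 1) \<le> k t\<close>,
  a range that varies with \<open>t\<close>. Summing over \<open>j < k\<close> instead gives one
  polynomial for all \<open>t > 0\<close>, as the additional terms vanish.\<close>

lemma poly_hyp_poly:
  assumes "t > 0" "1 \<le> k" "k \<le> Suc N"
  shows "poly (hyp_poly N k) (real t) = fact N * (box_fps t ^ Suc N) $ (k * t)"
proof -
  define c where "c j = (-1) ^ j * real (Suc N choose j)" for j
  define F where "F = Abs_fps (\<lambda>i. real ((N + i) choose N))"
  have expand: "(1 - fps_X ^ Suc t :: real fps) ^ Suc N = (\<Sum>j\<le>Suc N. fps_const (c j) * fps_X ^ (j * Suc t))"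
  proof -
    have "(1 - fps_X ^ Suc t :: real fps) ^ Suc N = (- (fps_X ^ Suc t) + 1) ^ Suc N"
      by simp
    also have "\<dots> = (\<Sum>j\<le>Suc N. of_nat (Suc N choose j) * (- (fps_X ^ Suc t)) ^ j)"
      unfolding binomial_ring by simp
    also have "\<dots> = (\<Sum>j\<le>Suc N. fps_const (c j) * fps_X ^ (j * Suc t))"
    proof (rule sum.cong)
      fix j
      have "(- (fps_X ^ Suc t)) ^ j = fps_const ((-1) ^ j :: real) * fps_X ^ (j * Suc t)"
        by (subst power_minus) (simp add: power_mult[symmetric] mult.commute flip: fps_const_power fps_const_neg del: power_Suc)
      then show "of_nat (Suc N choose j) * (- (fps_X ^ Suc t)) ^ j = fps_const (c j) * fps_X ^ (j * Suc t)"
        by (simp add: c_def fps_of_nat[symmetric] mult.assoc[symmetric] mult.commute del: binomial_Suc_Suc)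
    qed simp
    finally show ?thesis .
  qed
  have "(box_fps t ^ Suc N) $ (k * t) = (\<Sum>j\<le>Suc N. c j * (fps_X ^ (j * Suc t) * F) $ (k * t))"
    unfolding box_fps_power F_def[symmetric] expand
    by (simp only: sum_distrib_right fps_sum_nth mult.assoc fps_mult_left_const_nth)
  also have "\<dots> = (\<Sum>j<k. c j * (fps_X ^ (j * Suc t) * F) $ (k * t))"
  proof (rule sum.mono_neutral_right)
    show "\<forall>j\<in>{..Suc N} - {..<k}. c j * (fps_X ^ (j * Suc t) * F) $ (k * t) = 0"
    proof
      fix j assume "j \<in> {..Suc N} - {..<k}"
      then have "k * t < j * Suc t" using assms by (intro mult_le_less_imp_less) auto
      then show "c j * (fps_X ^ (j * Suc t) * F) $ (k * t) = 0"
        by (simp only: fps_X_power_mult_nth if_True mult_zero_right)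
    qed
  qed (use assms in auto)
  finally have "fact N * (box_fps t ^ Suc N) $ (k * t)
      = (\<Sum>j<k. c j * (fact N * (fps_X ^ (j * Suc t) * F) $ (k * t)))"
    by (simp add: sum_distrib_left ac_simps)
  also have "\<dots> = (\<Sum>j<k. c j * pochhammer (real (k - j) * real t - real j + 1) N)"
  proof (rule sum.cong)
    fix j assume "j \<in> {..<k}"
    then have j: "j < k" by simp
    show "c j * (fact N * (fps_X ^ (j * Suc t) * F) $ (k * t)) = c j * pochhammer (real (k - j) * real t - real j + 1) N"
    proof (cases "j * Suc t \<le> k * t")
      case True
      have *: "real (k - j) * real t - real j = real (k * t - j * Suc t)"
        using j by (subst of_nat_diff[OF True]) (simp add: of_nat_diff algebra_simps)
      show ?thesis
        unfolding * pochhammer_of_nat_eq using True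
        by (simp add: fps_X_power_mult_nth F_def del: mult_Suc_right)
    next
      case False
      \<comment> \<open>The polynomial term vanishes here although \<open>j < k\<close>: a factor of the Pochhammer symbol is zero.\<close>
      define r where "r = j * Suc t - k * t - 1"
      have "j * t + t \<le> k * t" using j mult_le_mono1[of "Suc j" k t] by simp
      \<comment> \<open>Since \<open>(k - j) t \<ge> t\<close>, the difference
        \<open>j (t + 1) - k t\<close> is at most \<open>j - t\<close>, and
        \<open>j \<le> N\<close>.\<close>
      then have "r < N" using False j assms by (simp add: r_def)
      moreover have "real (k - j) * real t - real j + 1 = - real r"
        using False j by (simp add: r_def of_nat_diff algebra_simps)
      ultimately have "pochhammer (real (k - j) * real t - real j + 1) N = 0"
        by (auto simp: pochhammer_eq_0_iff)
      then show ?thesis using False by (simp add: fps_X_power_mult_nth del: mult_Suc_right)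
    qed
  qed simp
  also have "\<dots> = poly (hyp_poly N k) (real t)"
    by (simp add: hyp_poly_def poly_sum poly_pcompose poly_pochhammer_poly c_def mult.commute)
  finally show ?thesis ..
qed

text \<open>Two candidates differ by a polynomial that vanishes at every positive integer, hence by
  zero.\<close>

lemma ehr_eqI:
  assumes "\<And>t::nat. t > 0 \<Longrightarrow> poly p (real t) = real (card (dilate (real t) P \<inter> integer_points n))"
  shows "ehr n P = p"
  unfolding ehr_def
proof (rule the_equality)
  fix q assume q: "\<forall>t::nat. t > 0 \<longrightarrow> poly q (real t) = real (card (dilate (real t) P \<inter> integer_points n))"
  show "q = p"
  proof (rule ccontr)
    assume "q \<noteq> p"
    then have "finite {x. poly (q - p) x = 0}" by (intro poly_roots_finite) simp
    moreover have "real ` {0<..} \<subseteq> {x. poly (q - p) x = 0}" using q assms by auto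
    ultimately have "finite (real ` {0::nat<..})" by (rule rev_finite_subset)
    then show False by (simp add: finite_image_iff infinite_Ioi)
  qed
qed (use assms in auto)

lemma ehr_panhandle:
  assumes "1 \<le> k" "k \<le> Suc N"
  shows "smult (fact (Suc N)) (ehr (N + 2) (panhandle_polytope (N + 2) k)) = [:real N + 1, real k:] * hyp_poly N k"
proof -
  have "ehr (N + 2) (panhandle_polytope (N + 2) k)
      = smult (1 / fact (Suc N)) ([:real N + 1, real k:] * hyp_poly N k)"
  proof (rule ehr_eqI)
    fix t :: nat assume t: "t > 0"
    define C where "C = real (card (dilate (real t) (panhandle_polytope (N + 2) k) \<inter> integer_points (N + 2)))"
    have "(real N + 1) * C = (real k * real t + real N + 1) * (box_fps t ^ Suc N) $ (k * t)"
      unfolding C_def using t assms by (intro panhandle_count_eq) auto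
    moreover have "fact (Suc N) * C = fact N * ((real N + 1) * C)"
      by (simp add: algebra_simps)
    ultimately have "fact (Suc N) * C = poly ([:real N + 1, real k:] * hyp_poly N k) (real t)"
      by (simp add: poly_hyp_poly[OF t assms] algebra_simps del: power_Suc fact_Suc)
    then show "poly (smult (1 / fact (Suc N)) ([:real N + 1, real k:] * hyp_poly N k)) (real t) = C"
      by (simp add: field_simps del: fact_Suc)
  qed
  then show ?thesis by (simp del: fact_Suc)
qed

text \<open>For \<open>k = n - 1\<close> all upper bounds are attained, so the polytope is a segment
  with Ehrhart polynomial \<open>t + 1\<close>. The coefficient of \<open>t^2\<close> is then 0, so
  the \<open>m \<le> 2\<close> of the opening statement cannot hold and the bound here is
  \<open>m \<le> 1\<close>.\<close>

theorem theorem4p3: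
  fixes n k m :: nat
  assumes "n \<ge> 2"
    and "(1 \<le> k \<and> k \<le> n - 2 \<and> m \<le> n - 1) \<or> (k = n - 1 \<and> m \<le> 1)"
  shows "coeff (smult (fact (n - 1)) (ehr n (panhandle_polytope n k))) m > 0"
proof -
  define N where "N = n - 2"
  have n: "n = N + 2" using assms(1) by (simp add: N_def)
  have k: "1 \<le> k" "k \<le> Suc N" and m: "k \<le> N \<and> m \<le> Suc N \<or> k = Suc N \<and> m \<le> 1"
    using assms(2) by (auto simp: n)
  have "coeff (smult (fact (n - 1)) (ehr n (panhandle_polytope n k))) m
      = (real N + 1) * coeff (hyp_poly N k) m + (if m = 0 then 0 else real k * coeff (hyp_poly N k) (m - 1))"
    using ehr_panhandle[OF k] by (cases m) (simp_all add: n del: fact_Suc)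
  \<comment> \<open>The linear factor \<open>k t + N + 1\<close> extends the positive range by one
    degree: at its end, \<open>m = N + 1\<close> or \<open>k = N + 1\<close> with
    \<open>m = 1\<close>, the coefficient at \<open>m - 1\<close> takes over.\<close>
  moreover have "coeff (hyp_poly N k) m > 0 \<or> m > 0 \<and> coeff (hyp_poly N k) (m - 1) > 0"
    using k m coeff_hyp_poly_pos[of k m N] coeff_hyp_poly_pos[of k "m - 1" N] by (cases m) auto
  ultimately show ?thesis
    using k coeff_hyp_poly_nonneg[of N k m] coeff_hyp_poly_nonneg[of N k "m - 1"]
    by (auto intro: add_pos_nonneg add_nonneg_pos)
qed

end
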